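(* Let $A$ be a C*-algebra. Then for every $\epsilon>0$ the annihilators $[A]^\perp$ are $\epsilon$-separative; that is, for all $B,C\in[A]^\perp$ with $B\subsetneqq C$ there exists $D\in[A]^\perp$ with $\{0\}\neq D\subseteq C$ and $\|BD\|\le\epsilon$.
   Context: For $a,b\in A$ write $a\perp b$ if $ab=0=ab^*$, and for $S\subseteq A$ put $S^\perp=\{b\in A:s\perp b\text{ for all }s\in S\}$. An annihilator of $A$ is a set of the form $S^\perp$, $S\subseteq A$; $[A]^\perp$ is the set of annihilators (each is a hereditary C*-subalgebra of $A$). For $B,D\in[A]^\perp$, $\|BD\|=\sup\{\|bd\|:b\in B^1_+,\ d\in D^1_+\}$, where $B^1_+$ denotes the set of positive elements of $B$ of norm at most $1$. *)

theory Defs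
  imports "HOL-Analysis.Analysis"
begin

text \<open>
  Complex C*-algebras, not necessarily unital and possibly zero. Submultiplicativity of the norm
  and completeness come from the superclasses.
\<close>

class cstar_algebra = real_normed_algebra + banach +
  fixes scaleC :: "complex \<Rightarrow> 'a \<Rightarrow> 'a"  (infixr "*\<^sub>C" 75)
    and star :: "'a \<Rightarrow> 'a"
  assumes scaleR_scaleC: "scaleR r x = complex_of_real r *\<^sub>C x"
    and scaleC_add_right: "c *\<^sub>C (x + y) = c *\<^sub>C x + c *\<^sub>C y"
    and scaleC_add_left: "(c + d) *\<^sub>C x = c *\<^sub>C x + d *\<^sub>C x"
    and scaleC_scaleC: "c *\<^sub>C d *\<^sub>C x = (c * d) *\<^sub>C x"
    and scaleC_one: "1 *\<^sub>C x = x"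
    and mult_scaleC_left: "(c *\<^sub>C x) * y = c *\<^sub>C (x * y)"
    and mult_scaleC_right: "x * (c *\<^sub>C y) = c *\<^sub>C (x * y)"
    and norm_scaleC: "norm (c *\<^sub>C x) = cmod c * norm x"
    and star_star: "star (star x) = x"
    and star_add: "star (x + y) = star x + star y"
    and star_scaleC: "star (c *\<^sub>C x) = cnj c *\<^sub>C star x"
    and star_mult: "star (x * y) = star y * star x"
    and norm_star_mult: "norm (star x * x) = (norm x)\<^sup>2"

instantiation complex :: cstar_algebra
begin

definition scaleC_complex :: "complex \<Rightarrow> complex \<Rightarrow> complex" where
  "scaleC_complex c x = c * x"

definition star_complex :: "complex \<Rightarrow> complex" where
  "star_complex = cnj"

instance
  by standard
    (simp_all add: scaleC_complex_def star_complex_def scaleR_conv_of_real algebra_simps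
      norm_mult power2_eq_square)

end

definition orth :: "'a::cstar_algebra \<Rightarrow> 'a \<Rightarrow> bool"  (infix "\<bottom>" 50) where
  "a \<bottom> b \<longleftrightarrow> a * b = 0 \<and> a * star b = 0"

definition annihilator :: "'a::cstar_algebra set \<Rightarrow> 'a set" where
  "annihilator S = {b. \<forall>s\<in>S. s \<bottom> b}"

definition annihilators :: "'a::cstar_algebra set set" where
  "annihilators = {annihilator S | S. True}"

definition positive :: "'a::cstar_algebra \<Rightarrow> bool" where
  "positive a \<longleftrightarrow> (\<exists>x. a = star x * x)"

definition pos_unit_ball :: "'a::cstar_algebra set \<Rightarrow> 'a set" where
  "pos_unit_ball B = {b \<in> B. positive b \<and> norm b \<le> 1}"

text \<open>
  For annihilators the real supremum below is a genuine one: both balls contain \<open>0\<close>, and the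
  values are bounded by \<open>1\<close>.
\<close>

definition norm_prod :: "'a::cstar_algebra set \<Rightarrow> 'a set \<Rightarrow> real" where
  "norm_prod B D = Sup {norm (b * d) | b d. b \<in> pos_unit_ball B \<and> d \<in> pos_unit_ball D}"

definition separative :: "real \<Rightarrow> 'a::cstar_algebra set set \<Rightarrow> bool" where
  "separative \<epsilon> P \<longleftrightarrow>
    (\<forall>B\<in>P. \<forall>C\<in>P. B \<subset> C \<longrightarrow> (\<exists>D\<in>P. {0} \<noteq> D \<and> D \<subseteq> C \<and> norm_prod B D \<le> \<epsilon>))"

end

theory Submission
  imports Defs
begin

text \<open>
  Let \<open>B = annihilator T\<close> be strictly contained in \<open>C = annihilator S\<close>. Some \<open>t \<in> T\<close> kills \<open>B\<close> from
  the left but does not kill \<open>C\<close>. Rescale \<open>t\<close> so that left multiplication by \<open>t\<close> has norm exactly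
  \<open>1\<close> on the right ideal \<open>R\<close> of all \<open>z\<close> with \<open>S z = 0\<close>. The idea is to choose \<open>D\<close> where this norm is
  almost attained. If \<open>t\<close> almost preserves the length of \<open>y \<in> R\<close>, then \<open>y\<close> is almost orthogonal to
  every self-adjoint contraction \<open>b \<in> B\<close>: as \<open>t b = 0\<close>, replacing \<open>y\<close> by \<open>y - b\<^sup>2 y\<close> does not
  change \<open>t y\<close>, but it shortens \<open>y\<close> by an amount controlled by \<open>b y\<close>, and \<open>t\<close> cannot increase
  lengths.

  To make this precise, take a positive contraction \<open>c\<close> in \<open>R\<close> and a number \<open>s < 1\<close> close to \<open>1\<close> with
  \<open>norm (t * c)\<^sup>2 > s\<close>, put \<open>h = star (t * c) * (t * c)\<close>, and let \<open>k\<close> be the negative part of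
  \<open>h - s\<close>. The condition \<open>k x = 0\<close> says that \<open>x\<close> lives in the part of the spectrum of \<open>h\<close>
  above \<open>s\<close>; there \<open>s |x|\<^sup>2 \<le> |t c x|\<^sup>2 \<le> |c x|\<^sup>2 \<le> |x|\<^sup>2\<close>, where \<open>|x|\<^sup>2\<close> abbreviates
  \<open>star x * x\<close>. This forces \<open>c x\<close> close to \<open>x\<close> and \<open>b c x\<close> close to \<open>0\<close>, hence \<open>b x\<close> close to \<open>0\<close>
  (\<open>almost_orthogonal_estimate\<close>). The elements of \<open>C\<close> killed by \<open>k\<close> on both sides form an annihilator
  \<open>D\<close>, and it is not zero because \<open>h\<close> times the positive part of \<open>h - s\<close> belongs to it (\<open>spectral_cut\<close>).

  The length inequalities have to be read in the order of a C*-algebra, and the negative part needs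
  a unit. Both are built by elementary means. A unit is adjoined with the norm of the operator of
  left multiplication. Square roots come from a fixed-point iteration,
  positivity is governed by the distance to the scalars (\<open>psd_norm_diff_le\<close>,
  \<open>psd_of_norm_le\<close>), negative parts come from the square root of \<open>a\<^sup>2\<close>, and with them
  every \<open>star x * x\<close> is shown to be positive (\<open>psd_star_mult\<close>). The passage from a norm
  inequality on a right ideal to an inequality in the order is \<open>contraction_on_right_ideal\<close>.
\<close>

section \<open>Involution and scalars\<close>

lemma star_zero [simp]: "star (0::'a::cstar_algebra) = 0"
  using star_add[of "0::'a" 0] by simp

lemma star_minus [simp]: "star (- x) = - star (x::'a::cstar_algebra)"
  using star_add[of x "- x"] by (simp add: eq_neg_iff_add_eq_0 add.commute)

lemma star_diff: "star (x - y) = star x - star (y::'a::cstar_algebra)"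
  using star_add[of x "- y"] by simp

lemma star_scaleR: "star (r *\<^sub>R x) = r *\<^sub>R star (x::'a::cstar_algebra)"
  by (simp add: scaleR_scaleC star_scaleC)

lemma scaleC_zero_right [simp]: "c *\<^sub>C (0::'a::cstar_algebra) = 0"
  using scaleC_add_right[of c "0::'a" 0] by simp

lemma scaleC_zero_left [simp]: "0 *\<^sub>C (x::'a::cstar_algebra) = 0"
  using scaleC_add_left[of 0 0 x] by simp

lemma scaleC_minus_right: "c *\<^sub>C (- x) = - (c *\<^sub>C (x::'a::cstar_algebra))"
  using scaleC_add_right[of c x "- x"] by (simp add: eq_neg_iff_add_eq_0 add.commute)

lemma scaleC_minus_left: "(- c) *\<^sub>C x = - (c *\<^sub>C (x::'a::cstar_algebra))"
  using scaleC_add_left[of c "- c" x] by (simp add: eq_neg_iff_add_eq_0 add.commute)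

lemma scaleC_diff_right: "c *\<^sub>C (x - y) = c *\<^sub>C x - c *\<^sub>C (y::'a::cstar_algebra)"
  using scaleC_add_right[of c x "- y"] by (simp add: scaleC_minus_right)

lemma norm_star [simp]: "norm (star x) = norm (x::'a::cstar_algebra)"
proof -
  have le: "norm y \<le> norm (star y)" for y :: 'a
  proof (cases "y = 0")
    case False
    have "norm y * norm y = norm (star y * y)"
      by (simp add: norm_star_mult power2_eq_square)
    also have "\<dots> \<le> norm (star y) * norm y"
      by (rule norm_mult_ineq)
    finally show ?thesis
      using False by simp
  qed simp
  show ?thesis
    using le[of x] le[of "star x"] by (simp add: star_star)
qed

lemma star_mult_self_eq_0 [simp]: "star x * x = 0 \<longleftrightarrow> x = (0::'a::cstar_algebra)"
  using norm_star_mult[of x] by auto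

lemma norm_mult_star: "norm (x * star x) = (norm (x::'a::cstar_algebra))\<^sup>2"
  using norm_star_mult[of "star x"] by (simp add: star_star)

lemma norm_selfadjoint_square: "star w = w \<Longrightarrow> norm (w * w) = (norm (w::'a::cstar_algebra))\<^sup>2"
  using norm_star_mult[of w] by simp

lemma selfadjoint_square_eq_0: "star w = w \<Longrightarrow> w * w = 0 \<Longrightarrow> w = (0::'a::cstar_algebra)"
  using star_mult_self_eq_0[of w] by simp

lemma bounded_linear_star: "bounded_linear (star :: 'a::cstar_algebra \<Rightarrow> 'a)"
  by (rule bounded_linear_intro[where K = 1]) (simp_all add: star_add star_scaleR)

lemma bounded_linear_scaleC: "bounded_linear (\<lambda>x::'a::cstar_algebra. c *\<^sub>C x)"
  by (rule bounded_linear_intro[where K = "cmod c"])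
    (simp_all add: scaleC_add_right scaleR_scaleC scaleC_scaleC mult.commute norm_scaleC)


section \<open>Adjoining a unit\<close>

datatype 'a unitization = Unitization (scalar_part: complex) (algebra_part: 'a)

text \<open>
  The action of \<open>u = \<lambda> + a\<close> on the original algebra by left multiplication. It determines the norm of
  the unitization, up to the scalar part.
\<close>

definition act :: "'a::cstar_algebra unitization \<Rightarrow> 'a \<Rightarrow> 'a" where
  "act u x = scalar_part u *\<^sub>C x + algebra_part u * x"

instantiation unitization :: (cstar_algebra) ring_1
begin

definition "0 = Unitization 0 0"
definition "1 = Unitization 1 0"
definition "u + v = Unitization (scalar_part u + scalar_part v) (algebra_part u + algebra_part v)"
definition "u - v = Unitization (scalar_part u - scalar_part v) (algebra_part u - algebra_part v)"
definition "- u = Unitization (- scalar_part u) (- algebra_part u)"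
definition "u * v = Unitization (scalar_part u * scalar_part v)
  (scalar_part u *\<^sub>C algebra_part v + scalar_part v *\<^sub>C algebra_part u
    + algebra_part u * algebra_part v)"

lemmas unitization_ring_defs = zero_unitization_def one_unitization_def plus_unitization_def
  minus_unitization_def uminus_unitization_def times_unitization_def

instance
  by standard
    (auto simp: unitization_ring_defs algebra_simps scaleC_add_right scaleC_add_left
      scaleC_scaleC mult_scaleC_left mult_scaleC_right scaleC_one mult.commute)

end

lemma act_zero: "act 0 = (\<lambda>x. 0)"
  by (auto simp: act_def unitization_ring_defs)

lemma act_one: "act 1 = (\<lambda>x. x)"
  by (auto simp: act_def unitization_ring_defs scaleC_one)

lemma act_add: "act (u + v) = (\<lambda>x. act u x + act v x)"
  by (auto simp: act_def unitization_ring_defs scaleC_add_left algebra_simps)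

lemma act_mult: "act (u * v) = act u \<circ> act v"
  by (auto simp: fun_eq_iff act_def unitization_ring_defs scaleC_add_right scaleC_add_left
      scaleC_scaleC mult_scaleC_left mult_scaleC_right algebra_simps)

lemma bounded_linear_act: "bounded_linear (act u)"
  unfolding act_def
  by (intro bounded_linear_add bounded_linear_scaleC bounded_linear_mult_right)

instantiation unitization :: (cstar_algebra) real_normed_algebra_1
begin

text \<open>
  The operator norm alone degenerates when \<open>'a\<close> already has a unit \<open>p\<close>: then \<open>1 - p\<close> acts as \<open>0\<close>. The
  maximum with the modulus of the scalar part, itself a C*-seminorm, repairs this.
\<close>

definition "scaleR r u =
  Unitization (complex_of_real r * scalar_part u) (complex_of_real r *\<^sub>C algebra_part u)"
definition "norm u = max (cmod (scalar_part u)) (onorm (act u))"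
definition "dist u v = norm (u - v :: 'a unitization)"
definition "sgn u = inverse (norm u) *\<^sub>R (u :: 'a unitization)"
definition [code del]:
  "(uniformity :: ('a unitization \<times> 'a unitization) filter) =
    (INF e\<in>{0<..}. principal {(x, y). dist x y < e})"
definition [code del]:
  "open (U :: 'a unitization set) \<longleftrightarrow>
    (\<forall>x\<in>U. eventually (\<lambda>(x', y). x' = x \<longrightarrow> y \<in> U) uniformity)"

text \<open>
  With \<open>norm_unitization_le\<close> this compares the norm with the product norm; definiteness and
  completeness follow. The element \<open>a\<close> is recovered from the action by testing on \<open>star a\<close>, since
  \<open>norm (a * star a) = (norm a)\<^sup>2\<close>.
\<close>

lemma norm_algebra_part_le: "norm (algebra_part u) \<le> 2 * norm (u :: 'a unitization)"
proof -
  define a where "a = algebra_part u"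
  have "norm a \<le> 2 * norm u"
  proof (cases "a = 0")
    case False
    have "norm a * norm a = norm (a * star a)"
      by (simp add: norm_mult_star power2_eq_square)
    also have "a * star a = act u (star a) - scalar_part u *\<^sub>C star a"
      by (simp add: act_def a_def)
    also have "norm \<dots> \<le> norm (act u (star a)) + norm (scalar_part u *\<^sub>C star a)"
      by (rule norm_triangle_ineq4)
    also have "\<dots> \<le> onorm (act u) * norm (star a) + cmod (scalar_part u) * norm (star a)"
      by (intro add_mono onorm bounded_linear_act) (simp add: norm_scaleC)
    also have "\<dots> \<le> norm u * norm a + norm u * norm a"
      by (intro add_mono) (simp_all add: mult_right_mono norm_unitization_def)
    finally have "norm a * norm a \<le> (2 * norm u) * norm a"
      by (simp add: algebra_simps)
    then show ?thesis
      using False by simp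
  qed (simp add: norm_unitization_def le_max_iff_disj)
  then show ?thesis
    by (simp add: a_def)
qed

lemma norm_unitization_le:
  "norm (u :: 'a unitization) \<le> cmod (scalar_part u) + norm (algebra_part u)"
proof -
  have "onorm (act u) \<le> cmod (scalar_part u) + norm (algebra_part u)"
  proof (rule onorm_bound)
    fix x
    show "norm (act u x) \<le> (cmod (scalar_part u) + norm (algebra_part u)) * norm x"
      unfolding act_def
      by (rule norm_triangle_le) (simp add: norm_scaleC norm_mult_ineq distrib_right)
  qed simp
  then show ?thesis
    by (simp add: norm_unitization_def)
qed

instance
proof
  fix u v :: "'a unitization" and r q :: real
  show "r *\<^sub>R (u + v) = r *\<^sub>R u + r *\<^sub>R v" "(r + q) *\<^sub>R u = r *\<^sub>R u + q *\<^sub>R u"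
    "r *\<^sub>R q *\<^sub>R u = (r * q) *\<^sub>R u" "1 *\<^sub>R u = u"
    "r *\<^sub>R u * v = r *\<^sub>R (u * v)" "u * r *\<^sub>R v = r *\<^sub>R (u * v)"
    by (simp_all add: unitization_ring_defs scaleR_unitization_def scaleC_add_right
        scaleC_add_left scaleC_scaleC scaleC_one mult_scaleC_left mult_scaleC_right algebra_simps)
  have "act (r *\<^sub>R u) = (\<lambda>x. r *\<^sub>R act u x)"
    by (auto simp: act_def scaleR_unitization_def scaleR_scaleC scaleC_add_right scaleC_scaleC
        mult_scaleC_left)
  then have "onorm (act (r *\<^sub>R u)) = \<bar>r\<bar> * onorm (act u)"
    by (simp add: onorm_scaleR bounded_linear_act)
  then show "norm (r *\<^sub>R u) = \<bar>r\<bar> * norm u"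
    by (simp add: norm_unitization_def max_mult_distrib_left)
      (simp add: scaleR_unitization_def norm_mult)
  show "norm (u + v) \<le> norm u + norm v"
  proof -
    have "cmod (scalar_part (u + v)) \<le> cmod (scalar_part u) + cmod (scalar_part v)"
      by (simp add: plus_unitization_def norm_triangle_ineq)
    moreover have "onorm (act (u + v)) \<le> onorm (act u) + onorm (act v)"
      unfolding act_add by (intro onorm_triangle bounded_linear_act)
    ultimately show ?thesis
      by (simp add: norm_unitization_def max_def)
  qed
  show "norm (u * v) \<le> norm u * norm v"
  proof -
    have "cmod (scalar_part (u * v)) \<le> norm u * norm v"
      by (simp add: times_unitization_def norm_mult norm_unitization_def mult_mono
          le_max_iff_disj)
    moreover have "onorm (act (u * v)) \<le> norm u * norm v"
    proof -
      have "onorm (act (u * v)) \<le> onorm (act u) * onorm (act v)"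
        unfolding act_mult by (intro onorm_compose bounded_linear_act)
      also have "\<dots> \<le> norm u * norm v"
        by (intro mult_mono) (auto simp: norm_unitization_def le_max_iff_disj
            onorm_pos_le[OF bounded_linear_act])
      finally show ?thesis .
    qed
    ultimately show ?thesis
      by (simp add: norm_unitization_def)
  qed
  have act_one_le: "onorm (act (1 :: 'a unitization)) \<le> 1"
    unfolding act_one by (rule onorm_bound) simp_all
  then show "norm (1 :: 'a unitization) = 1"
    by (simp add: norm_unitization_def) (simp add: one_unitization_def)
  show "(norm u = 0) = (u = 0)"
  proof
    assume "norm u = 0"
    then have "scalar_part u = 0"
      using norm_ge_zero[of "scalar_part u"] unfolding norm_unitization_def
      by (metis max.cobounded1 norm_le_zero_iff)
    moreover have "algebra_part u = 0"
      using norm_algebra_part_le[of u] \<open>norm u = 0\<close> by simp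
    ultimately show "u = 0"
      by (simp add: zero_unitization_def unitization.expand)
  next
    assume "u = 0"
    then show "norm u = 0"
      by (simp add: norm_unitization_def act_zero onorm_zero) (simp add: zero_unitization_def)
  qed
qed (simp_all add: dist_unitization_def sgn_unitization_def uniformity_unitization_def
    open_unitization_def)

end

instance unitization :: (cstar_algebra) banach
proof
  fix X :: "nat \<Rightarrow> 'a unitization"
  assume "Cauchy X"
  have "Cauchy (\<lambda>n. scalar_part (X n))" "Cauchy (\<lambda>n. algebra_part (X n))"
  proof -
    have parts: "dist (scalar_part (X m)) (scalar_part (X n)) \<le> dist (X m) (X n)"
      "dist (algebra_part (X m)) (algebra_part (X n)) \<le> 2 * dist (X m) (X n)" for m n
      using norm_algebra_part_le[of "X m - X n"]
      by (simp_all add: dist_norm dist_unitization_def)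
        (simp_all add: minus_unitization_def norm_unitization_def)
    show "Cauchy (\<lambda>n. scalar_part (X n))"
      using \<open>Cauchy X\<close> parts(1) unfolding Cauchy_def by (meson le_less_trans)
    show "Cauchy (\<lambda>n. algebra_part (X n))"
      unfolding Cauchy_def
    proof (intro allI impI)
      fix e :: real
      assume "0 < e"
      then obtain M where "\<And>m n. m \<ge> M \<Longrightarrow> n \<ge> M \<Longrightarrow> dist (X m) (X n) < e / 2"
        using \<open>Cauchy X\<close> unfolding Cauchy_def by (meson half_gt_zero)
      then have "dist (algebra_part (X m)) (algebra_part (X n)) < e" if "m \<ge> M" "n \<ge> M" for m n
        using parts(2)[of m n] that by fastforce
      then show "\<exists>M. \<forall>m\<ge>M. \<forall>n\<ge>M. dist (algebra_part (X m)) (algebra_part (X n)) < e"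
        by blast
    qed
  qed
  then obtain l a where lim: "(\<lambda>n. scalar_part (X n)) \<longlonglongrightarrow> l" "(\<lambda>n. algebra_part (X n)) \<longlonglongrightarrow> a"
    by (meson Cauchy_convergent convergent_def)
  have "(\<lambda>n. dist (scalar_part (X n)) l + dist (algebra_part (X n)) a) \<longlonglongrightarrow> 0"
    using tendsto_add[OF lim(1)[THEN tendsto_dist_iff[THEN iffD1]]
        lim(2)[THEN tendsto_dist_iff[THEN iffD1]]] by simp
  moreover have "dist (X n) (Unitization l a)
      \<le> dist (scalar_part (X n)) l + dist (algebra_part (X n)) a" for n
    using norm_unitization_le[of "X n - Unitization l a"]
    by (simp add: dist_norm dist_unitization_def) (simp add: minus_unitization_def)
  ultimately have small: "\<exists>N. \<forall>n\<ge>N. dist (X n) (Unitization l a) < e" if "0 < e" for e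
    using that unfolding lim_sequentially
    by (smt (verit, best) dist_real_def zero_le_dist)
  then have "X \<longlonglongrightarrow> Unitization l a"
    by (simp add: lim_sequentially)
  then show "convergent X"
    by (simp add: convergent_def exI[of _ "Unitization l a"])
  qed

instantiation unitization :: (cstar_algebra) cstar_algebra
begin

definition "scaleC c u = Unitization (c * scalar_part u) (c *\<^sub>C algebra_part u)"
definition "star u = Unitization (cnj (scalar_part u)) (star (algebra_part u))"

lemmas unitization_defs = unitization_ring_defs scaleC_unitization_def star_unitization_def

lemma act_star_act: "star x * act (star u * u) x = star (act u x) * act u (x :: 'a)"
  by (simp add: act_def unitization_defs star_add star_scaleC star_mult star_star
      mult_scaleC_left mult_scaleC_right scaleC_scaleC scaleC_add_left scaleC_add_right
      algebra_simps)

text \<open>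
  The C*-identity of \<open>'a\<close> at \<open>act u x\<close> expresses \<open>(norm (act u x))\<^sup>2\<close> through \<open>act (star u * u) x\<close>,
  which bounds \<open>(onorm (act u))\<^sup>2\<close> by \<open>onorm (act (star u * u))\<close>. This in turn makes \<open>star\<close>
  isometric for the operator norm, and submultiplicativity gives the other inequality.
\<close>

lemma onorm_act_star_mult: "onorm (act (star u * u)) = (onorm (act (u :: 'a unitization)))\<^sup>2"
proof -
  have nonneg: "0 \<le> onorm (act v)" for v :: "'a unitization"
    by (rule onorm_pos_le[OF bounded_linear_act])
  have le: "(onorm (act v))\<^sup>2 \<le> onorm (act (star v * v))" for v :: "'a unitization"
  proof -
    have "onorm (act v) \<le> sqrt (onorm (act (star v * v)))"
    proof (rule onorm_bound)
      show "norm (act v x) \<le> sqrt (onorm (act (star v * v))) * norm x" for x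
      proof (rule power2_le_imp_le)
        have "(norm (act v x))\<^sup>2 = norm (star x * act (star v * v) x)"
          by (simp add: act_star_act norm_star_mult)
        also have "\<dots> \<le> norm x * norm (act (star v * v) x)"
          using norm_mult_ineq[of "star x" "act (star v * v) x"] by simp
        also have "\<dots> \<le> norm x * (onorm (act (star v * v)) * norm x)"
          by (intro mult_left_mono onorm bounded_linear_act) simp
        also have "\<dots> = (sqrt (onorm (act (star v * v))) * norm x)\<^sup>2"
          by (simp add: power_mult_distrib nonneg power2_eq_square)
        finally show "(norm (act v x))\<^sup>2 \<le> (sqrt (onorm (act (star v * v))) * norm x)\<^sup>2" .
      qed (simp add: nonneg)
    qed (simp add: nonneg)
    then have "(onorm (act v))\<^sup>2 \<le> (sqrt (onorm (act (star v * v))))\<^sup>2"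
      by (intro power_mono nonneg)
    then show ?thesis
      by (simp add: nonneg)
  qed
  have compose: "onorm (act (v * w)) \<le> onorm (act v) * onorm (act w)" for v w :: "'a unitization"
    unfolding act_mult by (intro onorm_compose bounded_linear_act)
  have star_le: "onorm (act v) \<le> onorm (act (star v))" for v :: "'a unitization"
  proof (cases "onorm (act v) = 0")
    case False
    have "onorm (act v) * onorm (act v) \<le> onorm (act (star v)) * onorm (act v)"
      using le[of v] compose[of "star v" v] by (simp add: power2_eq_square)
    then show ?thesis
      using False nonneg[of v] by (simp add: mult_le_cancel_right)
  qed (simp add: nonneg)
  have "star (star u) = u"
    by (simp add: star_unitization_def star_star)
  then have "onorm (act (star u)) \<le> onorm (act u)"
    using star_le[of "star u"] by simp
  then have "onorm (act (star u * u)) \<le> onorm (act u) * onorm (act u)"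
    using compose[of "star u" u] nonneg[of u] by (meson mult_right_mono order_trans)
  then show ?thesis
    using le[of u] by (simp add: power2_eq_square)
qed

instance
proof
  fix u v :: "'a unitization" and c d :: complex and r :: real
  show "r *\<^sub>R u = complex_of_real r *\<^sub>C u"
    by (simp add: scaleR_unitization_def scaleC_unitization_def)
  show "c *\<^sub>C (u + v) = c *\<^sub>C u + c *\<^sub>C v" "(c + d) *\<^sub>C u = c *\<^sub>C u + d *\<^sub>C u"
    "c *\<^sub>C d *\<^sub>C u = (c * d) *\<^sub>C u" "1 *\<^sub>C u = u"
    "c *\<^sub>C u * v = c *\<^sub>C (u * v)" "u * c *\<^sub>C v = c *\<^sub>C (u * v)"
    "star (star u) = u" "star (u + v) = star u + star v" "star (c *\<^sub>C u) = cnj c *\<^sub>C star u"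
    "star (u * v) = star v * star u"
    by (simp_all add: unitization_defs scaleC_add_right scaleC_add_left scaleC_scaleC scaleC_one
        mult_scaleC_left mult_scaleC_right star_star star_add star_scaleC star_mult algebra_simps)
  have "act (c *\<^sub>C u) = (\<lambda>x. c *\<^sub>C act u x)"
    by (auto simp: act_def scaleC_unitization_def scaleC_add_right scaleC_scaleC mult_scaleC_left)
  moreover have "onorm (\<lambda>x. c *\<^sub>C act u x) = onorm (\<lambda>x. cmod c *\<^sub>R act u x)"
    by (simp add: onorm_def norm_scaleC)
  ultimately have "onorm (act (c *\<^sub>C u)) = cmod c * onorm (act u)"
    by (simp add: onorm_scaleR bounded_linear_act)
  then show "norm (c *\<^sub>C u) = cmod c * norm u"
    by (simp add: norm_unitization_def max_mult_distrib_left)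
      (simp add: scaleC_unitization_def norm_mult)
  show "norm (star u * u) = (norm u)\<^sup>2"
  proof -
    have "cmod (scalar_part (star u * u)) = (cmod (scalar_part u))\<^sup>2"
      by (simp add: star_unitization_def times_unitization_def norm_mult power2_eq_square)
    moreover have "max (x\<^sup>2) (y\<^sup>2) = (max x y)\<^sup>2" if "0 \<le> x" "0 \<le> y" for x y :: real
      using that by (auto simp: max_def power_mono)
    ultimately show ?thesis
      by (simp add: norm_unitization_def onorm_act_star_mult onorm_pos_le[OF bounded_linear_act])
  qed
qed

end

section \<open>Positivity in a unital algebra\<close>

lemma star_one [simp]: "star (1 :: 'a::{cstar_algebra,real_normed_algebra_1}) = 1"
proof -
  have "star 1 = star (star 1) * star (1 :: 'a)"
    by (simp add: star_star)
  also have "\<dots> = star (1 * star 1)"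
    by (simp only: star_mult)
  finally show ?thesis
    by (simp add: star_star)
qed

lemma star_of_real [simp]:
  "star (of_real r :: 'a::{cstar_algebra,real_normed_algebra_1}) = of_real r"
  by (simp add: of_real_def star_scaleR)

lemma of_real_commute: "of_real r * x = x * (of_real r :: 'a::real_algebra_1)"
  by (simp add: of_real_def)

text \<open>
  Writing \<open>w = 1 - v\<close>, the equation \<open>w\<^sup>2 = 1 - y\<close> becomes \<open>v = (y + v\<^sup>2) / 2\<close>, which is solved by
  iteration from \<open>0\<close>. For \<open>norm y = 1\<close> the map is not a strict contraction, but the steps
  are dominated by those of the scalar iteration \<open>r \<mapsto> (1 + r\<^sup>2) / 2\<close>, which increases and stays
  below \<open>1\<close>. Everything that commutes with \<open>y\<close> commutes with the iterates and so with the limit.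
\<close>

lemma sqrt_near_one:
  fixes y :: "'a::{cstar_algebra,real_normed_algebra_1}"
  assumes "star y = y" "norm y \<le> 1"
  obtains w where "star w = w" "w * w = 1 - y" "norm (1 - w) \<le> 1"
    "\<And>z. z * y = y * z \<Longrightarrow> z * w = w * z"
proof -
  define r where "r = rec_nat (0::real) (\<lambda>_ r. (1 + r\<^sup>2) / 2)"
  define v where "v = rec_nat (0::'a) (\<lambda>_ v. (y + v * v) /\<^sub>R 2)"
  have r [simp]: "r 0 = 0" "r (Suc n) = (1 + (r n)\<^sup>2) / 2" for n
    by (simp_all add: r_def)
  have v [simp]: "v 0 = 0" "v (Suc n) = (y + v n * v n) /\<^sub>R 2" for n
    by (simp_all add: v_def)
  have r_bounds: "0 \<le> r n \<and> r n \<le> 1" for n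
    by (induction n) (auto simp: power_le_one)
  have norm_v: "norm (v n) \<le> r n" for n
  proof (induction n)
    case (Suc n)
    have "norm (v n * v n) \<le> (r n)\<^sup>2"
      using norm_mult_ineq[of "v n" "v n"] mult_mono[OF Suc Suc] r_bounds[of n]
      by (simp add: power2_eq_square)
    then have "norm (y + v n * v n) \<le> 1 + (r n)\<^sup>2"
      using norm_triangle_ineq[of y "v n * v n"] assms(2) by linarith
    then show ?case
      by simp
  qed simp
  have step: "norm (v (Suc n) - v n) \<le> r (Suc n) - r n" for n
  proof (induction n)
    case 0
    then show ?case
      using assms(2) by simp
  next
    case (Suc n)
    let ?d = "v (Suc n) - v n" and ?e = "r (Suc n) - r n"
    have "v (Suc (Suc n)) - v (Suc n) = (v (Suc n) * ?d + ?d * v n) /\<^sub>R 2"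
      by (simp only: v(2)[of "Suc n"] v(2)[of n, symmetric])
        (simp only: v(2)[of n] algebra_simps)
    moreover have "norm (v (Suc n) * ?d + ?d * v n) \<le> r (Suc n) * ?e + ?e * r n"
    proof (rule norm_triangle_le, rule add_mono)
      show "norm (v (Suc n) * ?d) \<le> r (Suc n) * ?e"
        using norm_mult_ineq mult_mono[OF norm_v Suc.IH] r_bounds norm_ge_zero
        by (meson order_trans)
      show "norm (?d * v n) \<le> ?e * r n"
        using norm_mult_ineq mult_mono[OF Suc.IH norm_v] Suc.IH norm_ge_zero
        by (meson order_trans)
    qed
    moreover have "(r (Suc n) * ?e + ?e * r n) / 2 = r (Suc (Suc n)) - r (Suc n)"
      by (simp only: r(2)[of "Suc n"]) (simp add: power2_eq_square field_simps)
    ultimately show ?case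
      by simp
  qed
  have "r n \<le> r (Suc n)" for n
    using step[of n] norm_ge_zero[of "v (Suc n) - v n"] by linarith
  then have "incseq r"
    by (rule incseq_SucI)
  then have "Cauchy r"
    using incseq_convergent[of r 1] r_bounds by (metis convergent_Cauchy convergentI)
  have diff: "norm (v (n + m) - v n) \<le> r (n + m) - r n" for n m
  proof (induction m)
    case (Suc m)
    then show ?case
      using step[of "n + m"] norm_triangle_ineq[of "v (n + Suc m) - v (n + m)" "v (n + m) - v n"]
      by (simp del: v r)
  qed simp
  have "Cauchy v"
  proof (rule CauchyI')
    fix e :: real
    assume "0 < e"
    then obtain M where M: "\<And>m n. m \<ge> M \<Longrightarrow> n \<ge> M \<Longrightarrow> norm (r m - r n) < e"
      using \<open>Cauchy r\<close> unfolding Cauchy_iff by blast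
    have "dist (v m) (v n) < e" if "M \<le> m" "m < n" for m n
      using diff[of m "n - m"] M[of n m] that by (simp add: dist_norm norm_minus_commute)
    then show "\<exists>M. \<forall>m\<ge>M. \<forall>n>m. dist (v m) (v n) < e"
      by blast
  qed
  then obtain x where x: "v \<longlonglongrightarrow> x"
    by (meson Cauchy_convergent convergent_def)
  have "(\<lambda>n. v (Suc n)) \<longlonglongrightarrow> (y + x * x) /\<^sub>R 2"
    unfolding v by (intro tendsto_intros x)
  then have fixpoint: "x = (y + x * x) /\<^sub>R 2"
    using x LIMSEQ_Suc LIMSEQ_unique by blast
  have "star (v n) = v n" for n
    by (induction n) (simp_all add: star_add star_mult star_scaleR assms(1))
  then have "star x = x"
    using bounded_linear.tendsto[OF bounded_linear_star x] x LIMSEQ_unique by auto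
  show ?thesis
  proof (rule that[of "1 - x"])
    show "star (1 - x) = 1 - x"
      by (simp add: star_diff \<open>star x = x\<close>)
    have "2 *\<^sub>R x = y + x * x"
      by (subst fixpoint) simp
    then show "(1 - x) * (1 - x) = 1 - y"
      by (simp add: algebra_simps scaleR_2)
    have "norm (v n) \<le> 1" for n
      using norm_v[of n] r_bounds[of n] by simp
    then show "norm (1 - (1 - x)) \<le> 1"
      using LIMSEQ_le_const2[OF tendsto_norm[OF x]] by simp
  next
    fix z
    assume z: "z * y = y * z"
    have "z * v n = v n * z" for n
    proof (induction n)
      case (Suc n)
      then have "z * (v n * v n) = v n * v n * z"
        by (metis mult.assoc)
      then show ?case
        by (simp add: z algebra_simps)
    qed simp
    then have "(\<lambda>n. v n * z) \<longlonglongrightarrow> z * x"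
      using tendsto_mult[OF tendsto_const[of z] x] by simp
    then have "z * x = x * z"
      using tendsto_mult[OF x tendsto_const[of z]] LIMSEQ_unique by blast
    then show "z * (1 - x) = (1 - x) * z"
      by (simp add: algebra_simps)
  qed
qed


text \<open>
  Positivity as being the square of a self-adjoint element. The form \<open>star x * x\<close> gives the same
  elements, but only by \<open>psd_star_mult\<close>, whose proof uses that such squares form a cone.
\<close>

definition psd :: "'a::cstar_algebra \<Rightarrow> bool" where
  "psd a \<longleftrightarrow> (\<exists>w. star w = w \<and> a = w * w)"

abbreviation psd_le :: "'a::cstar_algebra \<Rightarrow> 'a \<Rightarrow> bool" (infix "\<preceq>" 50) where
  "a \<preceq> b \<equiv> psd (b - a)"

lemma psd_selfadjoint: "psd a \<Longrightarrow> star a = a"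
  by (auto simp: psd_def star_mult)

lemma psd_square: "star w = w \<Longrightarrow> psd (w * w)"
  by (auto simp: psd_def)

lemma psd_scaleR: "psd a \<Longrightarrow> 0 \<le> r \<Longrightarrow> psd (r *\<^sub>R a)"
proof -
  assume "psd a" "0 \<le> r"
  then obtain w where "star w = w" "a = w * w"
    by (auto simp: psd_def)
  then have "star (sqrt r *\<^sub>R w) = sqrt r *\<^sub>R w" "r *\<^sub>R a = (sqrt r *\<^sub>R w) * (sqrt r *\<^sub>R w)"
    using \<open>0 \<le> r\<close> by (simp_all add: star_scaleR)
  then show "psd (r *\<^sub>R a)"
    unfolding psd_def by blast
qed

lemma psd_sqrt:
  fixes a :: "'a::{cstar_algebra,real_normed_algebra_1}"
  assumes "star a = a" "0 \<le> r" "norm (of_real r - a) \<le> r"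
  obtains w where "star w = w" "w * w = a" "norm (of_real (sqrt r) - w) \<le> sqrt r"
    "\<And>z. z * a = a * z \<Longrightarrow> z * w = w * z"
proof (cases "r = 0")
  case True
  then show ?thesis
    using assms that[of 0] by simp
next
  case False
  then have "0 < r"
    using assms(2) by simp
  define y where "y = 1 - a /\<^sub>R r"
  have "star y = y"
    by (simp add: y_def star_diff star_scaleR assms(1))
  have "norm y = norm ((of_real r - a) /\<^sub>R r)"
    using \<open>0 < r\<close> by (simp add: y_def scaleR_diff_right of_real_def)
  also have "\<dots> \<le> 1"
    using assms(3) \<open>0 < r\<close> by (simp only: norm_scaleR) (simp add: divide_simps)
  finally have "norm y \<le> 1" .
  then obtain w where w: "star w = w" "w * w = 1 - y" "norm (1 - w) \<le> 1"
      "\<And>z. z * y = y * z \<Longrightarrow> z * w = w * z"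
    using sqrt_near_one[OF \<open>star y = y\<close>] by metis
  show ?thesis
  proof (rule that[of "sqrt r *\<^sub>R w"])
    show "star (sqrt r *\<^sub>R w) = sqrt r *\<^sub>R w"
      by (simp add: star_scaleR w(1))
    have "sqrt r *\<^sub>R w * sqrt r *\<^sub>R w = (sqrt r * sqrt r) *\<^sub>R (w * w)"
      by simp
    then show "sqrt r *\<^sub>R w * sqrt r *\<^sub>R w = a"
      using \<open>0 < r\<close> by (simp add: w(2) y_def)
    have "of_real (sqrt r) - sqrt r *\<^sub>R w = sqrt r *\<^sub>R (1 - w)"
      by (simp add: of_real_def scaleR_diff_right)
    then show "norm (of_real (sqrt r) - sqrt r *\<^sub>R w) \<le> sqrt r"
      using w(3) \<open>0 < r\<close> by (simp add: mult_left_le)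
    show "z * sqrt r *\<^sub>R w = sqrt r *\<^sub>R w * z" if "z * a = a * z" for z
      using w(4)[of z] that by (simp add: y_def algebra_simps)
  qed
qed

lemma psd_of_norm_le:
  fixes a :: "'a::{cstar_algebra,real_normed_algebra_1}"
  assumes "star a = a" "norm (of_real r - a) \<le> r"
  shows "psd a"
proof -
  have "0 \<le> r"
    using assms(2) norm_ge_zero order_trans by blast
  then obtain w where "star w = w" "w * w = a"
    using psd_sqrt[OF assms(1) _ assms(2)] by metis
  then show ?thesis
    using psd_square by metis
qed

text \<open>
  The element \<open>u = w + \<i> v\<close> satisfies \<open>star u * u = r\<close>, so it is \<open>sqrt r\<close> times an isometry, and
  \<open>w\<close> is its real part.
\<close>

lemma norm_le_of_commuting_squares:
  fixes v w :: "'a::{cstar_algebra,real_normed_algebra_1}"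
  assumes "star v = v" "star w = w" "v * w = w * v" "w * w + v * v = of_real r" "0 \<le> r"
  shows "(norm w)\<^sup>2 \<le> r"
proof -
  define u where "u = w + \<i> *\<^sub>C v"
  have star_u: "star u = w - \<i> *\<^sub>C v"
    by (simp add: u_def star_add star_scaleC assms scaleC_minus_left)
  have "star u * u = w * w + v * v"
    unfolding star_u by (simp add: u_def algebra_simps mult_scaleC_left mult_scaleC_right scaleC_scaleC
        scaleC_diff_right scaleC_add_right scaleC_minus_left scaleC_one assms(3))
  then have "(norm u)\<^sup>2 = r"
    using norm_star_mult[of u] assms(4,5) by simp
  have "u + star u = 2 *\<^sub>R w"
    unfolding star_u by (simp add: u_def scaleR_2)
  then have "2 * norm w = norm (u + star u)"
    by simp
  also have "\<dots> \<le> 2 * norm u"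
    using norm_triangle_ineq[of u "star u"] by simp
  finally show ?thesis
    using \<open>(norm u)\<^sup>2 = r\<close> power_mono[of "norm w" "norm u" 2] by simp
qed

text \<open>
  The converse of \<open>psd_of_norm_le\<close>. Together they describe positivity by a norm inequality
  that is stable under sums and limits. Here \<open>r - a\<close> is within \<open>r\<close> of \<open>r\<close>, so it has a root \<open>v\<close> that
  commutes with a root \<open>w\<close> of \<open>a\<close>, and \<open>w\<^sup>2 + v\<^sup>2 = r\<close>.
\<close>

lemma psd_norm_diff_le:
  fixes a :: "'a::{cstar_algebra,real_normed_algebra_1}"
  assumes "psd a" "norm a \<le> r"
  shows "norm (of_real r - a) \<le> r"
proof -
  obtain w where w: "star w = w" "a = w * w"
    using assms(1) by (auto simp: psd_def)
  have "0 \<le> r"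
    using assms(2) norm_ge_zero order_trans by blast
  moreover have "star (of_real r - a) = of_real r - a" "norm (of_real r - (of_real r - a)) \<le> r"
    using assms by (simp_all add: star_diff psd_selfadjoint)
  ultimately obtain v where v: "star v = v" "v * v = of_real r - a"
      "\<And>z. z * (of_real r - a) = (of_real r - a) * z \<Longrightarrow> z * v = v * z"
    using psd_sqrt by metis
  have "w * v = v * w"
    by (rule v(3)) (simp add: w(2) algebra_simps of_real_commute)
  then have "(norm v)\<^sup>2 \<le> r"
    using norm_le_of_commuting_squares[OF w(1) v(1)] v(2) w(2) \<open>w * v = v * w\<close> \<open>0 \<le> r\<close> by simp
  then show ?thesis
    using norm_selfadjoint_square[OF v(1)] v(2) by simp
qed

lemma le_of_real_norm:
  fixes a :: "'a::{cstar_algebra,real_normed_algebra_1}"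
  assumes "star a = a" "norm a \<le> r"
  shows "a \<preceq> of_real r"
  by (rule psd_of_norm_le[of _ r]) (use assms in \<open>simp_all add: star_diff\<close>)

lemma psd_add:
  fixes a b :: "'a::{cstar_algebra,real_normed_algebra_1}"
  assumes "psd a" "psd b"
  shows "psd (a + b)"
proof (rule psd_of_norm_le)
  show "star (a + b) = a + b"
    using assms by (simp add: star_add psd_selfadjoint)
  have "of_real (norm a + norm b) - (a + b) = (of_real (norm a) - a) + (of_real (norm b) - b)"
    by simp
  then show "norm (of_real (norm a + norm b) - (a + b)) \<le> norm a + norm b"
    by (simp only:)
      (intro norm_triangle_le add_mono psd_norm_diff_le assms order_refl)
qed

lemma psd_le_trans:
  fixes a b c :: "'a::{cstar_algebra,real_normed_algebra_1}"
  assumes "a \<preceq> b" "b \<preceq> c"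
  shows "a \<preceq> c"
  using psd_add[OF assms] by (simp add: algebra_simps)

text \<open>
  Again \<open>w\<^sup>2 + v\<^sup>2 = r\<close> for roots of \<open>a\<close> and \<open>r - a\<close>; the root of \<open>a\<close> is taken from
  \<open>psd_sqrt\<close>, because an arbitrary one need not commute with \<open>v\<close>.
\<close>

lemma norm_le_of_le_of_real:
  fixes a :: "'a::{cstar_algebra,real_normed_algebra_1}"
  assumes "psd a" "a \<preceq> of_real r" "0 \<le> r"
  shows "norm a \<le> r"
proof -
  have "norm (of_real (norm a) - a) \<le> norm a"
    by (rule psd_norm_diff_le) (simp_all add: assms)
  then obtain w where w: "star w = w" "w * w = a" "\<And>z. z * a = a * z \<Longrightarrow> z * w = w * z"
    using psd_sqrt[of a "norm a"] assms(1) psd_selfadjoint norm_ge_zero by metis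
  obtain v where v: "star v = v" "of_real r - a = v * v"
    using assms(2) by (auto simp: psd_def)
  have "v * a = v * (of_real r - (of_real r - a))"
    by simp
  also have "\<dots> = (of_real r - (of_real r - a)) * v"
    unfolding v(2) by (simp only: algebra_simps of_real_commute)
  finally have "v * w = w * v"
    by (intro w(3)) simp
  moreover have "w * w + v * v = of_real r"
    by (simp add: w(2) flip: v(2))
  ultimately show ?thesis
    using norm_le_of_commuting_squares[of v w r] v(1) w(1,2) \<open>v * w = w * v\<close> assms(3) norm_selfadjoint_square[OF w(1)]
    by simp
qed

lemma norm_mono_psd:
  fixes a b :: "'a::{cstar_algebra,real_normed_algebra_1}"
  assumes "psd a" "a \<preceq> b"
  shows "norm a \<le> norm b"
proof (rule norm_le_of_le_of_real)
  have "psd b"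
    using psd_add[OF assms] by simp
  then have "b \<preceq> of_real (norm b)"
    by (intro le_of_real_norm psd_selfadjoint) simp_all
  with assms(2) show "a \<preceq> of_real (norm b)"
    by (rule psd_le_trans)
qed (simp_all add: assms)

lemma psd_antisym:
  fixes a :: "'a::{cstar_algebra,real_normed_algebra_1}"
  assumes "psd a" "psd (- a)"
  shows "a = 0"
  using norm_le_of_le_of_real[of a 0] assms by simp

lemma psd_closed:
  fixes a :: "'a::{cstar_algebra,real_normed_algebra_1}"
  assumes "\<And>\<eta>. 0 < \<eta> \<Longrightarrow> psd (a + of_real \<eta>)"
  shows "psd a"
proof (rule psd_of_norm_le)
  have "star (a + of_real 1) = a + of_real 1"
    by (intro psd_selfadjoint assms) simp
  then show "star a = a"
    by (simp add: star_add)
  show "norm (of_real (norm a) - a) \<le> norm a"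
  proof (rule field_le_epsilon)
    fix e :: real
    assume "0 < e"
    have "norm (of_real (norm a + e / 2) - (a + of_real (e / 2))) \<le> norm a + e / 2"
    proof (rule psd_norm_diff_le)
      show "norm (a + of_real (e / 2)) \<le> norm a + e / 2"
        using norm_triangle_ineq[of a "of_real (e / 2)"] \<open>0 < e\<close> by (simp only: norm_of_real)
    qed (simp add: assms \<open>0 < e\<close>)
    then show "norm (of_real (norm a) - a) \<le> norm a + e"
      using \<open>0 < e\<close> by simp
  qed
qed

text \<open>
  With \<open>w\<close> the positive root of \<open>a\<^sup>2\<close>, that is \<open>|a|\<close>, the element \<open>k = (w - a) / 2\<close> is the negative
  part of \<open>a\<close>, and \<open>a + k + k = w\<close>. The equation \<open>k * a = - (k * k)\<close> says that \<open>k\<close> kills the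
  positive part \<open>a + k\<close>. Instead of positivity of \<open>k\<close> only that of \<open>k\<^sup>3 = k w k\<close> is recorded: it
  is immediate from a commuting root of \<open>w\<close>, and it suffices below.
\<close>

lemma negative_part:
  fixes a :: "'a::{cstar_algebra,real_normed_algebra_1}"
  assumes "star a = a"
  obtains k where "star k = k" "k * a = - (k * k)" "psd (k * k * k)"
    "psd (a + k + k)" "\<And>z. z * a = a * z \<Longrightarrow> z * k = k * z"
proof -
  have "norm (of_real (norm (a * a)) - a * a) \<le> norm (a * a)"
    by (intro psd_norm_diff_le psd_square assms) simp
  then obtain w where w: "star w = w" "w * w = a * a"
      "norm (of_real (sqrt (norm (a * a))) - w) \<le> sqrt (norm (a * a))"
      "\<And>z. z * (a * a) = a * a * z \<Longrightarrow> z * w = w * z"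
    using psd_sqrt[of "a * a" "norm (a * a)"] assms by (metis norm_ge_zero star_mult)
  obtain v where v: "star v = v" "v * v = w" "\<And>z. z * w = w * z \<Longrightarrow> z * v = v * z"
    using psd_sqrt[OF w(1) _ w(3)] by (metis norm_ge_zero real_sqrt_ge_zero)
  define m where "m = w - a"
  define k where "k = m /\<^sub>R 2"
  have a_w: "a * w = w * a"
    by (rule w(4)) (simp add: mult.assoc)
  have k: "star k = k"
    by (simp add: k_def m_def star_scaleR star_diff w(1) assms)
  have m_m: "m * m = - (2 *\<^sub>R (m * a))" and a_m: "a * m = m * a"
    by (simp_all add: m_def algebra_simps w(2) a_w scaleR_2)
  have ka: "k * a = - (k * k)"
    by (simp add: k_def m_m)
  have a_k: "a * k = k * a"
    by (simp add: k_def a_m)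
  have "k + k = m"
    using scaleR_add_left[of "1/2" "1/2" m] by (simp add: k_def)
  then have w_k: "w = a + k + k"
    by (simp add: m_def add.assoc)
  have k_w: "k * w = w * k"
    by (simp add: w_k algebra_simps a_k)
  then have k_v: "k * v = v * k"
    by (rule v(3))
  have "k * k * k = (v * k) * (v * k)"
  proof -
    have "(v * k) * (v * k) = v * v * (k * k)"
      by (metis k_v mult.assoc)
    also have "\<dots> = k * w * k"
      by (simp add: v(2) k_w mult.assoc)
    also have "\<dots> = k * k * k"
      by (simp add: w_k algebra_simps ka)
    finally show ?thesis
      by simp
  qed
  moreover have "star (v * k) = v * k"
    by (simp add: star_mult v(1) k k_v)
  ultimately have "psd (k * k * k)"
    using psd_square by metis
  moreover have "psd (a + k + k)"
    using psd_square[OF v(1)] v(2) w_k by simp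
  moreover have "z * k = k * z" if "z * a = a * z" for z
  proof -
    have "z * (a * a) = a * a * z"
      using that by (metis mult.assoc)
    then have "z * w = w * z"
      by (rule w(4))
    then show ?thesis
      by (simp add: k_def m_def algebra_simps that)
  qed
  ultimately show ?thesis
    using that k ka by metis
qed

text \<open>
  The core of the positivity of \<open>star z * z\<close>. With \<open>n = - (star z * z)\<close> positive, so is
  \<open>p = z * star z\<close>, since \<open>p - n\<close> is a sum of squares. For \<open>z \<noteq> 0\<close> the
  intertwining \<open>z (r + n) = (r - p) z\<close>, with \<open>r = norm p = norm n\<close>, is then contradictory: the right
  side has norm at most \<open>r * norm z\<close>, while the factor \<open>r + n\<close> makes the left side longer.
\<close>

lemma eq_0_of_psd_minus_star_mult:
  fixes z :: "'a::{cstar_algebra,real_normed_algebra_1}"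
  assumes "psd (- (star z * z))"
  shows "z = 0"
proof (rule ccontr)
  assume "z \<noteq> 0"
  define p where "p = z * star z"
  define n where "n = - (star z * z)"
  define r where "r = (norm z)\<^sup>2"
  have "0 < r"
    using \<open>z \<noteq> 0\<close> by (simp add: r_def)
  obtain y where y: "star y = y" "n = y * y"
    using assms by (auto simp: psd_def n_def)
  have norm_p: "norm p = r" and norm_n: "norm n = r"
    by (simp_all add: p_def n_def r_def norm_mult_star norm_star_mult)
  have "psd p"
  proof -
    define g where "g = z + star z"
    define h where "h = \<i> *\<^sub>C (z - star z)"
    have "star g = g" "star h = h"
      by (simp_all add: g_def h_def star_add star_diff star_scaleC star_star scaleC_diff_right
          scaleC_minus_left)
    then have "psd (g * g + h * h)"
      by (intro psd_add psd_square)
    then have "psd ((g * g + h * h) /\<^sub>R 2)"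
      by (intro psd_scaleR) simp_all
    then have "psd ((g * g + h * h) /\<^sub>R 2 + n)"
      using assms by (intro psd_add) (simp_all add: n_def)
    moreover have "h * h = - ((z - star z) * (z - star z))"
      by (simp add: h_def mult_scaleC_left mult_scaleC_right scaleC_scaleC scaleC_minus_left
          scaleC_one)
    then have "g * g + h * h = 2 *\<^sub>R (p - n)"
      by (simp add: g_def p_def n_def algebra_simps scaleR_2)
    ultimately show ?thesis
      by simp
  qed
  then have "norm (of_real r - p) \<le> r"
    by (rule psd_norm_diff_le) (simp add: norm_p)
  define x where "x = z * (of_real r + n)"
  have "x = (of_real r - p) * z"
    by (simp add: x_def n_def p_def algebra_simps of_real_commute)
  then have "norm x \<le> r * norm z"
    using norm_mult_ineq[of "of_real r - p" z] \<open>norm (of_real r - p) \<le> r\<close>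
    by (meson mult_right_mono norm_ge_zero order_trans)
  then have "(norm x)\<^sup>2 \<le> (r * norm z)\<^sup>2"
    by (rule power_mono) simp
  then have upper: "(norm x)\<^sup>2 \<le> r ^ 3"
    by (simp add: power_mult_distrib power3_eq_cube power2_eq_square r_def)
  have "star n = n"
    by (simp add: y star_mult)
  have "star x * x = (of_real r + n) * (star z * z) * (of_real r + n)"
    by (simp add: x_def star_mult star_add \<open>star n = n\<close> mult.assoc)
  also have "star z * z = - n"
    by (simp add: n_def)
  finally have star_x_x: "star x * x = - (r\<^sup>2 *\<^sub>R n + (2 * r) *\<^sub>R (n * n) + n * n * n)"
    using scaleR_add_left[of r r "n * n"] by (simp add: of_real_def algebra_simps power2_eq_square)
  have "norm ((2 * r) *\<^sub>R (n * n)) \<le> norm (r\<^sup>2 *\<^sub>R n + (2 * r) *\<^sub>R (n * n) + n * n * n)"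
  proof (rule norm_mono_psd)
    show "psd ((2 * r) *\<^sub>R (n * n))"
      using \<open>0 < r\<close> by (intro psd_scaleR psd_square \<open>star n = n\<close>) simp
    have "psd (n * n * n)"
    proof -
      have "n * n * n = (y * y * y) * (y * y * y)"
        by (simp add: y mult.assoc)
      moreover have "psd \<dots>"
        by (rule psd_square) (simp add: star_mult y mult.assoc)
      ultimately show ?thesis
        by simp
    qed
    then have "psd (r\<^sup>2 *\<^sub>R n + n * n * n)"
      using assms by (intro psd_add psd_scaleR) (simp_all add: n_def)
    then show "(2 * r) *\<^sub>R (n * n) \<preceq> r\<^sup>2 *\<^sub>R n + (2 * r) *\<^sub>R (n * n) + n * n * n"
      by (simp add: algebra_simps)
  qed
  also have "\<dots> = (norm x)\<^sup>2"
    using norm_star_mult[of x] unfolding star_x_x by (simp only: norm_minus_cancel)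
  finally have "2 * r ^ 3 \<le> (norm x)\<^sup>2"
    using norm_selfadjoint_square[OF \<open>star n = n\<close>] \<open>0 < r\<close> norm_n
    by (simp add: power3_eq_cube power2_eq_square)
  with upper \<open>0 < r\<close> show False
    by (smt (verit) zero_less_power)
qed

text \<open>
  If \<open>k\<close> is the negative part of \<open>star x * x\<close>, then \<open>star (x * k) * (x * k) = - k\<^sup>3\<close>, so \<open>x * k = 0\<close>
  and \<open>k\<close> vanishes.
\<close>

lemma psd_star_mult:
  fixes x :: "'a::{cstar_algebra,real_normed_algebra_1}"
  shows "psd (star x * x)"
proof -
  have "star (star x * x) = star x * x"
    by (simp add: star_mult star_star)
  then obtain k where k: "star k = k" "k * (star x * x) = - (k * k)" "psd (k * k * k)"
      "psd (star x * x + k + k)"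
    by (rule negative_part)
  have "star (x * k) * (x * k) = k * (star x * x) * k"
    by (simp add: star_mult k(1) mult.assoc)
  then have "psd (- (star (x * k) * (x * k)))"
    by (simp add: k)
  then have "x * k = 0"
    by (rule eq_0_of_psd_minus_star_mult)
  then have "k * star x = 0"
    by (metis k(1) star_mult star_zero)
  then have "k * k = 0"
    using k(2) by (simp flip: mult.assoc)
  then have "k = 0"
    using k(1) selfadjoint_square_eq_0 by blast
  then show ?thesis
    using k(4) by simp
qed

lemma psd_conj:
  fixes a :: "'a::{cstar_algebra,real_normed_algebra_1}"
  assumes "psd a"
  shows "psd (star x * a * x)"
proof -
  obtain w where "star w = w" "a = w * w"
    using assms by (auto simp: psd_def)
  then have "star x * a * x = star (w * x) * (w * x)"
    by (simp add: star_mult mult.assoc)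
  then show ?thesis
    by (simp only: psd_star_mult)
qed


section \<open>Contractions on right ideals\<close>

text \<open>
  A norm bound on a whole right ideal is an order bound at each of its elements, because elements can
  be localised by right multiplication. If \<open>star z * z - star (t * z) * (t * z) + \<eta>\<close> had a negative part
  \<open>k \<noteq> 0\<close>, then \<open>|t z k|\<^sup>2\<close> would exceed \<open>|z k|\<^sup>2\<close> by at least \<open>\<eta> k\<^sup>2\<close>, hence by a fixed multiple of
  \<open>|z k|\<^sup>2\<close>, against \<open>norm (t * (z * k)) \<le> norm (z * k)\<close>. The margin \<open>\<eta>\<close> is essential here: between
  positive elements \<open>P \<le> Q\<close>, equality of norms does not give \<open>P = Q\<close>.
\<close>

lemma contraction_on_right_ideal:
  fixes R :: "'a::{cstar_algebra,real_normed_algebra_1} set"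
  assumes ideal: "\<And>z u. z \<in> R \<Longrightarrow> z * u \<in> R"
    and contraction: "\<And>z. z \<in> R \<Longrightarrow> norm (t * z) \<le> norm z"
    and "z \<in> R"
  shows "star (t * z) * (t * z) \<preceq> star z * z"
proof (rule psd_closed)
  fix \<eta> :: real
  assume "0 < \<eta>"
  define f where "f = star z * z - star (t * z) * (t * z) + of_real \<eta>"
  have "star f = f"
    by (simp add: f_def star_add star_diff star_mult star_star mult.assoc)
  then obtain k where k: "star k = k" "k * f = - (k * k)" "psd (k * k * k)" "psd (f + k + k)"
    by (rule negative_part)
  \<comment> \<open>a bound for \<open>star z * z\<close>; the \<open>1\<close> keeps it strictly positive when \<open>z = 0\<close>\<close>
  define m where "m = (norm z)\<^sup>2 + 1"
  have "0 < m"
    by (simp add: m_def add_nonneg_pos)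
  define P where "P = star (z * k) * (z * k)"
  define Q where "Q = star (t * (z * k)) * (t * (z * k))"
  have "psd P"
    by (simp add: P_def psd_star_mult)
  have "k * f * k = P - Q + \<eta> *\<^sub>R (k * k)"
    by (simp add: f_def P_def Q_def star_mult k(1) algebra_simps of_real_def)
  then have "Q = P + \<eta> *\<^sub>R (k * k) - k * f * k"
    by simp
  then have Q: "Q = P + \<eta> *\<^sub>R (k * k) + k * k * k"
    by (simp add: k(2))
  have "star z * z \<preceq> of_real m"
    by (rule le_of_real_norm) (simp_all add: m_def norm_star_mult star_mult star_star)
  then have "psd (star k * (of_real m - star z * z) * k)"
    by (rule psd_conj)
  also have "star k * (of_real m - star z * z) * k = m *\<^sub>R (k * k) - P"
    by (simp add: P_def star_mult k(1) algebra_simps of_real_def)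
  finally have "psd ((\<eta> / m) *\<^sub>R (m *\<^sub>R (k * k) - P) + k * k * k)"
    using \<open>0 < m\<close> \<open>0 < \<eta>\<close> by (intro psd_add psd_scaleR k(3)) auto
  also have "(\<eta> / m) *\<^sub>R (m *\<^sub>R (k * k) - P) + k * k * k = Q - (1 + \<eta> / m) *\<^sub>R P"
    using \<open>0 < m\<close> by (simp add: Q algebra_simps)
  finally have "norm ((1 + \<eta> / m) *\<^sub>R P) \<le> norm Q"
    using \<open>0 < m\<close> \<open>0 < \<eta>\<close> \<open>psd P\<close> by (intro norm_mono_psd psd_scaleR) auto
  also have "\<dots> \<le> norm P"
    using contraction[OF ideal[OF \<open>z \<in> R\<close>, of k]]
    by (simp add: P_def Q_def norm_star_mult power_mono)
  finally have "(1 + \<eta> / m) * norm P \<le> norm P"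
    using \<open>0 < m\<close> \<open>0 < \<eta>\<close> by simp
  then have "(\<eta> / m) * norm P \<le> 0"
    by (simp add: algebra_simps)
  then have "P = 0"
    using \<open>0 < m\<close> \<open>0 < \<eta>\<close> by (simp add: zero_less_divide_iff mult_le_0_iff not_less divide_le_0_iff)
  then have "Q = 0"
    by (simp add: P_def Q_def)
  then have "\<eta> *\<^sub>R (k * k) = - (k * k * k)"
    using Q \<open>P = 0\<close> by (simp add: eq_neg_iff_add_eq_0)
  moreover have "psd (\<eta> *\<^sub>R (k * k))"
    using \<open>0 < \<eta>\<close> by (intro psd_scaleR psd_square k(1)) simp
  ultimately have "\<eta> *\<^sub>R (k * k) = 0"
    using k(3) psd_antisym[of "\<eta> *\<^sub>R (k * k)"] by simp
  then have "k = 0"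
    using \<open>0 < \<eta>\<close> k(1) selfadjoint_square_eq_0 by auto
  then show "psd (star z * z - star (t * z) * (t * z) + of_real \<eta>)"
    using k(4) by (simp add: f_def)
qed


section \<open>Almost orthogonal elements\<close>

text \<open>
  With \<open>y = c x\<close> and \<open>y' = y - b\<^sup>2 y\<close>, the equality \<open>t y' = t y\<close> gives
  \<open>s |x|\<^sup>2 \<le> |t y|\<^sup>2 \<le> |y'|\<^sup>2 \<le> |y|\<^sup>2 - |b y|\<^sup>2 \<le> |x|\<^sup>2 - |b y|\<^sup>2\<close>. So \<open>|b y|\<^sup>2 \<le> (1 - s) |x|\<^sup>2\<close>, and also
  \<open>s |x|\<^sup>2 \<le> |c x|\<^sup>2\<close>, which keeps \<open>x - c x\<close> small because \<open>(1 - c)\<^sup>2 \<le> 1 - c\<^sup>2\<close> for a positive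
  contraction \<open>c\<close>. The two bounds add up to the factor \<open>2\<close>.
\<close>

lemma almost_orthogonal_estimate:
  fixes b c t x :: "'a::{cstar_algebra,real_normed_algebra_1}"
  assumes b: "star b = b" "norm b \<le> 1" "t * b = 0"
    and c: "psd c" "norm c \<le> 1"
    and upper: "star (t * (c * x - b * b * (c * x))) * (t * (c * x - b * b * (c * x)))
      \<preceq> star (c * x - b * b * (c * x)) * (c * x - b * b * (c * x))"
    and lower: "s *\<^sub>R (star x * x) \<preceq> star (t * (c * x)) * (t * (c * x))"
    and "s \<le> 1"
  shows "norm (b * x) \<le> 2 * sqrt (1 - s) * norm x"
proof -
  define y where "y = c * x"
  define y' where "y' = y - b * b * y"
  define X where "X = star x * x"
  define Y where "Y = star y * y"
  define B where "B = star (b * y) * (b * y)"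
  have star_c: "star c = c"
    using c(1) by (rule psd_selfadjoint)
  have unit: "1 - w * w = of_real 1 - w * w" for w :: 'a
    by simp
  have contr: "psd (1 - w * w)" if "star w = w" "norm w \<le> 1" for w :: 'a
  proof -
    have "norm (w * w) \<le> 1"
      using that by (simp add: norm_selfadjoint_square power_le_one)
    then show ?thesis
      unfolding unit using that(1) by (intro le_of_real_norm) (simp_all add: star_mult)
  qed
  have "t * y' = t * y"
    by (simp add: y'_def algebra_simps b(3) flip: mult.assoc)
  then have "s *\<^sub>R X \<preceq> star y' * y'"
    using lower upper unfolding y_def[symmetric] y'_def[symmetric] X_def[symmetric]
    by (metis psd_le_trans)
  moreover have "star y' * y' \<preceq> Y - B"
  proof -
    have "Y - B - star y' * y' = star (b * y) * (1 - b * b) * (b * y)"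
      by (simp add: Y_def B_def y'_def star_diff star_mult b(1) algebra_simps)
    then show ?thesis
      using psd_conj contr[OF b(1,2)] by metis
  qed
  ultimately have sX: "s *\<^sub>R X \<preceq> Y - B"
    by (rule psd_le_trans)
  have YX: "Y \<preceq> X"
  proof -
    have "X - Y = star x * (1 - c * c) * x"
      by (simp add: X_def Y_def y_def star_mult star_c algebra_simps)
    then show ?thesis
      using psd_conj contr[OF star_c c(2)] by metis
  qed
  have psd_B: "psd B"
    by (simp add: B_def psd_star_mult)
  have norm_X: "norm ((1 - s) *\<^sub>R X) = (1 - s) * (norm x)\<^sup>2"
    using \<open>s \<le> 1\<close> by (simp add: X_def norm_star_mult)
  have sqrt_bound: "norm w \<le> sqrt (1 - s) * norm x"
    if "star w * w \<preceq> (1 - s) *\<^sub>R X" for w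
  proof -
    have "(norm w)\<^sup>2 \<le> (1 - s) * (norm x)\<^sup>2"
      using norm_mono_psd[OF psd_star_mult that] norm_X by (simp add: norm_star_mult)
    then have "sqrt ((norm w)\<^sup>2) \<le> sqrt ((1 - s) * (norm x)\<^sup>2)"
      by (rule real_sqrt_le_mono)
    then show ?thesis
      by (simp add: real_sqrt_mult)
  qed
  have "norm (b * y) \<le> sqrt (1 - s) * norm x"
  proof (rule sqrt_bound)
    have "(1 - s) *\<^sub>R X - star (b * y) * (b * y) = (Y - B - s *\<^sub>R X) + (X - Y)"
      by (simp add: B_def algebra_simps)
    then show "star (b * y) * (b * y) \<preceq> (1 - s) *\<^sub>R X"
      using psd_add[OF sX YX] by simp
  qed
  moreover have "norm (x - y) \<le> sqrt (1 - s) * norm x"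
  proof (rule sqrt_bound)
    obtain q where q: "star q = q" "c = q * q"
      using c(1) by (auto simp: psd_def)
    have "norm q \<le> 1"
      using c(2) norm_selfadjoint_square[OF q(1)] by (simp add: q(2) abs_square_le_1)
    have "c - c * c = star q * (1 - q * q) * q"
      by (simp add: q algebra_simps)
    then have "psd (c - c * c)"
      using psd_conj contr[OF q(1) \<open>norm q \<le> 1\<close>] by metis
    then have "psd (star x * (c - c * c) * x)"
      by (rule psd_conj)
    then have cY: "psd (star x * c * x - Y)"
      by (simp add: Y_def y_def star_mult star_c algebra_simps)
    have "psd (Y - s *\<^sub>R X)"
      using psd_add[OF sX psd_B] by (simp add: algebra_simps)
    then have "psd ((Y - s *\<^sub>R X) + ((star x * c * x - Y) + (star x * c * x - Y)))"
      by (intro psd_add cY)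
    also have "(Y - s *\<^sub>R X) + ((star x * c * x - Y) + (star x * c * x - Y))
        = (1 - s) *\<^sub>R X - star (x - y) * (x - y)"
      by (simp add: X_def Y_def y_def star_mult star_diff star_c algebra_simps)
    finally show "star (x - y) * (x - y) \<preceq> (1 - s) *\<^sub>R X" .
  qed
  moreover have "norm (b * x) \<le> norm (x - y) + norm (b * y)"
  proof -
    have "norm (b * (x - y)) \<le> norm (x - y)"
      using norm_mult_ineq[of b "x - y"] b(2) by (meson mult_left_le_one_le norm_ge_zero order_trans)
    moreover have "b * x = b * (x - y) + b * y"
      by (simp add: algebra_simps)
    ultimately show ?thesis
      using norm_triangle_ineq[of "b * (x - y)" "b * y"] by simp
  qed
  ultimately show ?thesis
    by simp
qed

text \<open>
  Here \<open>k\<close> is the negative and \<open>h - s + k\<close> the positive part of \<open>h - s\<close>, whose product is \<open>0\<close>. The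
  factor \<open>h\<close> will bring the product back from the unitization into the algebra. If the product with
  \<open>h\<close> were \<open>0\<close>, then \<open>h |h - s| h = s h\<^sup>2 - h\<^sup>3\<close>, so that \<open>h\<^sup>3 \<le> s h\<^sup>2\<close> and \<open>norm h \<le> s\<close>.
\<close>

lemma spectral_cut:
  fixes h k :: "'a::{cstar_algebra,real_normed_algebra_1}"
  assumes "psd h" "0 < s" "s < norm h"
    and k: "star k = k" "h * k = k * h" "k * (h - of_real s) = - (k * k)"
      "psd (h - of_real s + k + k)"
  shows "h * (h - of_real s + k) \<noteq> 0" "k * (h * (h - of_real s + k)) = 0"
    "star (h * (h - of_real s + k)) = h * (h - of_real s + k)"
proof -
  define p where "p = h - of_real s + k"
  have star_h: "star h = h"
    using assms(1) by (rule psd_selfadjoint)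
  have "k * p = 0"
    using k(3) by (simp add: p_def algebra_simps)
  have "k * (h * p) = h * (k * p)"
    by (simp add: k(2) flip: mult.assoc)
  then show "k * (h * (h - of_real s + k)) = 0"
    by (simp add: \<open>k * p = 0\<close> flip: p_def)
  show "star (h * (h - of_real s + k)) = h * (h - of_real s + k)"
    by (simp add: star_mult star_add star_diff star_h k(1,2) algebra_simps of_real_commute)
  show "h * (h - of_real s + k) \<noteq> 0"
  proof
    assume "h * (h - of_real s + k) = 0"
    moreover have "h * k = h * (h - of_real s + k) + s *\<^sub>R h - h * h"
      by (simp add: algebra_simps of_real_def)
    ultimately have hk: "h * k = s *\<^sub>R h - h * h"
      by simp
    have "psd (star h * (h - of_real s + k + k) * h)"
      by (rule psd_conj) (rule k(4))
    also have "star h * (h - of_real s + k + k) * h = (h * p + h * k) * h"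
      by (simp add: star_h p_def algebra_simps)
    also have "\<dots> = (h * k) * h"
      using \<open>h * (h - of_real s + k) = 0\<close> by (simp add: p_def)
    also have "\<dots> = s *\<^sub>R (h * h) - h * h * h"
      unfolding hk by (simp add: algebra_simps)
    finally have "h * h * h \<preceq> s *\<^sub>R (h * h)" .
    moreover have "psd (h * h * h)"
      using psd_conj[OF assms(1), of h] by (simp add: star_h)
    ultimately have "norm (h * h * h) \<le> norm (s *\<^sub>R (h * h))"
      by (intro norm_mono_psd)
    then have "norm (h * h * h) \<le> s * (norm h)\<^sup>2"
      using \<open>0 < s\<close> norm_selfadjoint_square[OF star_h] by simp
    moreover have "(norm h)\<^sup>2 * (norm h)\<^sup>2 \<le> norm (h * h * h) * norm h"
    proof -
      have "norm ((h * h) * (h * h)) = (norm h)\<^sup>2 * (norm h)\<^sup>2"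
        using norm_selfadjoint_square[of "h * h"] norm_selfadjoint_square[OF star_h]
        by (simp add: star_mult star_h power2_eq_square)
      moreover have "(h * h) * (h * h) = h * h * h * h"
        by (simp add: mult.assoc)
      ultimately show ?thesis
        using norm_mult_ineq[of "h * h * h" h] by simp
    qed
    ultimately have "(norm h)\<^sup>2 * (norm h)\<^sup>2 \<le> (s * (norm h)\<^sup>2) * norm h"
      by (meson mult_right_mono norm_ge_zero order_trans)
    then have "norm h * (norm h)^3 \<le> s * (norm h)^3"
      by (simp add: power2_eq_square power3_eq_cube mult_ac)
    then show False
      using assms(2,3) by (simp add: mult_le_cancel_right)
  qed
qed

text \<open>
  The factorisation \<open>e = u * t * v\<close> is what places \<open>e\<close> in every two-sided ideal that contains \<open>t\<close>; for
  the unitization this is the original algebra.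
\<close>

lemma almost_orthogonal_spectral_part:
  fixes S :: "'a::{cstar_algebra,real_normed_algebra_1} set"
  assumes z0: "\<And>s. s \<in> S \<Longrightarrow> s * z0 = 0" "t * z0 \<noteq> 0" and "0 < \<epsilon>"
  obtains e u v k where "e = u * t * v" "e \<noteq> 0" "star e = e" "\<And>s. s \<in> S \<Longrightarrow> s * e = 0"
    "k * e = 0"
    "\<And>b x. star b = b \<Longrightarrow> norm b \<le> 1 \<Longrightarrow> t * b = 0 \<Longrightarrow> (\<And>s. s \<in> S \<Longrightarrow> s * b = 0) \<Longrightarrow>
      (\<And>s. s \<in> S \<Longrightarrow> s * x = 0) \<Longrightarrow> k * x = 0 \<Longrightarrow> norm (b * x) \<le> \<epsilon> * norm x"
proof -
  define R where "R = {z. \<forall>s\<in>S. s * z = 0}"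
  define M where "M = (SUP z\<in>{z\<in>R. norm z \<le> 1}. norm (t * z))"
  have ideal: "z * u \<in> R" if "z \<in> R" for z u
    using that by (simp add: R_def flip: mult.assoc)
  have scaleR_R: "r *\<^sub>R z \<in> R" if "z \<in> R" for r z
    using that by (simp add: R_def)
  have "0 \<in> R"
    by (simp add: R_def)
  have bdd: "bdd_above ((\<lambda>z. norm (t * z)) ` {z\<in>R. norm z \<le> 1})"
  proof (rule bdd_aboveI2)
    show "norm (t * z) \<le> norm t" if "z \<in> {z\<in>R. norm z \<le> 1}" for z
      using norm_mult_ineq[of t z] that mult_left_le[of "norm z" "norm t"] by simp
  qed
  have le_M: "norm (t * z) \<le> M * norm z" if "z \<in> R" for z
  proof (cases "z = 0")
    case False
    have "norm (t * (z /\<^sub>R norm z)) \<le> M"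
      unfolding M_def using bdd False that by (intro cSUP_upper) (simp_all add: scaleR_R)
    then show ?thesis
      using False by (simp add: divide_simps mult.commute)
  qed simp
  have "0 < M"
  proof -
    have "0 < norm (t * z0)" "z0 \<noteq> 0" "norm (t * z0) \<le> M * norm z0"
      using z0 le_M[of z0] by (auto simp: R_def)
    then show ?thesis
      by (metis norm_ge_zero not_less order_less_le_trans mult_nonpos_nonneg)
  qed
  define t' where "t' = t /\<^sub>R M"
  have contraction: "norm (t' * z) \<le> norm z" if "z \<in> R" for z
    using le_M[OF that] \<open>0 < M\<close> by (simp add: t'_def divide_simps mult.commute)
  \<comment> \<open>chosen so that the factor \<open>2 * sqrt (1 - s)\<close> of the estimate is at most \<open>\<epsilon>\<close>\<close>
  define \<delta> where "\<delta> = min (1/2) (\<epsilon> / 2)"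
  define s where "s = 1 - \<delta>\<^sup>2"
  have \<delta>: "0 < \<delta>" "\<delta> \<le> 1/2" "2 * \<delta> \<le> \<epsilon>"
    using \<open>0 < \<epsilon>\<close> by (auto simp: \<delta>_def)
  then have "\<delta>\<^sup>2 \<le> (1/2)\<^sup>2"
    by (intro power_mono) auto
  then have s: "0 < s" "s < 1" "sqrt (1 - s) = \<delta>"
    using \<delta>(1) by (simp_all add: s_def power2_eq_square)
  have "M * sqrt s < M"
    using \<open>0 < M\<close> s(2) by simp
  then obtain z where z: "z \<in> R" "norm z \<le> 1" "M * sqrt s < norm (t * z)"
    using less_cSUP_iff[OF _ bdd, of "M * sqrt s"] \<open>0 \<in> R\<close> unfolding M_def by force
  have "sqrt s < norm (t' * z)"
    using z(3) \<open>0 < M\<close> by (simp add: t'_def divide_simps mult.commute)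
  then have "(sqrt s)\<^sup>2 < (norm (t' * z))\<^sup>2"
    using s(1) by (intro power_strict_mono) auto
  then have t'z: "s < (norm (t' * z))\<^sup>2"
    using s(1) by simp
  \<comment> \<open>passing from \<open>z\<close> to \<open>c = |star z|\<close> makes it self-adjoint without changing \<open>norm (t' * z)\<close>\<close>
  have "psd (z * star z)"
    using psd_star_mult[of "star z"] by (simp add: star_star)
  then obtain c where c: "star c = c" "c * c = z * star z"
      "norm (of_real (sqrt (norm (z * star z))) - c) \<le> sqrt (norm (z * star z))"
    using psd_sqrt[of "z * star z" "norm (z * star z)"] psd_norm_diff_le psd_selfadjoint
    by (metis norm_ge_zero order_refl)
  then have "psd c"
    by (intro psd_of_norm_le)
  have norm_c: "norm c = norm z"
    using norm_selfadjoint_square[OF c(1)] norm_mult_star[of z] by (simp add: c(2))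
  have "c \<in> R"
  proof -
    have "r * c = 0" if "r \<in> S" for r
    proof -
      have "star (star (r * c)) * star (r * c) = (r * z) * star (r * z)"
        using c(2) by (simp add: star_star star_mult c(1) mult.assoc) (metis mult.assoc)
      also have "\<dots> = 0"
        using z(1) that by (simp add: R_def)
      finally show ?thesis
        by (metis star_mult_self_eq_0 star_star star_zero)
    qed
    then show ?thesis
      by (simp add: R_def)
  qed
  define h where "h = star (t' * c) * (t' * c)"
  have "psd h"
    by (simp add: h_def psd_star_mult)
  have "norm h = norm ((t' * c) * star (t' * c))"
    by (simp add: h_def norm_star_mult norm_mult_star)
  also have "(t' * c) * star (t' * c) = (t' * z) * star (t' * z)"
    using c(2) by (simp add: star_mult c(1) mult.assoc) (metis mult.assoc)
  finally have norm_h: "s < norm h"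
    using t'z by (simp add: norm_mult_star)
  have "star (h - of_real s) = h - of_real s"
    by (simp add: star_diff psd_selfadjoint \<open>psd h\<close>)
  then obtain k where k: "star k = k" "k * (h - of_real s) = - (k * k)"
      "psd (h - of_real s + k + k)"
      "\<And>z. z * (h - of_real s) = (h - of_real s) * z \<Longrightarrow> z * k = k * z"
    using negative_part by metis
  have "h * k = k * h"
    by (rule k(4)) (simp add: algebra_simps of_real_commute)
  define e where "e = h * (h - of_real s + k)"
  have e: "e \<noteq> 0" "k * e = 0" "star e = e"
    unfolding e_def
    using spectral_cut[OF \<open>psd h\<close> s(1) norm_h k(1) \<open>h * k = k * h\<close> k(2,3)] by auto
  show ?thesis
  proof (rule that[of e "star (t' * c) /\<^sub>R M" "c * (h - of_real s + k)" k])
    show "e = star (t' * c) /\<^sub>R M * t * (c * (h - of_real s + k))"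
      by (simp add: e_def h_def t'_def mult.assoc)
    show "r * e = 0" if "r \<in> S" for r
    proof -
      have "r * e = (r * c) * star t' * t' * c * (h - of_real s + k)"
        by (simp add: e_def h_def star_mult c(1) mult.assoc)
      then show ?thesis
        using \<open>c \<in> R\<close> that by (simp add: R_def)
    qed
    fix b x
    assume b: "star b = b" "norm b \<le> 1" "t * b = 0" "\<And>s. s \<in> S \<Longrightarrow> s * b = 0"
      and x: "\<And>s. s \<in> S \<Longrightarrow> s * x = 0" "k * x = 0"
    have "norm (b * x) \<le> 2 * sqrt (1 - s) * norm x"
    proof (rule almost_orthogonal_estimate[where c = c and t = t'])
      show "t' * b = 0"
        by (simp add: t'_def b(3))
      have "b \<in> R"
        using b(4) by (simp add: R_def)
      then have "c * x - b * b * (c * x) \<in> R"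
        using ideal[OF \<open>c \<in> R\<close>, of x] ideal[OF \<open>b \<in> R\<close>, of "b * (c * x)"]
        by (simp add: R_def algebra_simps)
      then show "star (t' * (c * x - b * b * (c * x))) * (t' * (c * x - b * b * (c * x)))
          \<preceq> star (c * x - b * b * (c * x)) * (c * x - b * b * (c * x))"
        using contraction_on_right_ideal[of R t'] ideal contraction by blast
      have "psd (star x * (h - of_real s + k + k) * x)"
        using k(3) by (rule psd_conj)
      also have "star x * (h - of_real s + k + k) * x
          = star (t' * (c * x)) * (t' * (c * x)) - s *\<^sub>R (star x * x)"
        by (simp add: h_def star_mult c(1) algebra_simps x(2) of_real_def)
      finally show "s *\<^sub>R (star x * x) \<preceq> star (t' * (c * x)) * (t' * (c * x))" .
    qed (use b \<open>psd c\<close> norm_c z(2) s in simp_all)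
    also have "\<dots> \<le> \<epsilon> * norm x"
      using \<delta>(3) s(3) by (simp add: mult_right_mono)
    finally show "norm (b * x) \<le> \<epsilon> * norm x" .
  qed (use e in simp_all)
qed


section \<open>Annihilators\<close>

definition embed :: "'a::cstar_algebra \<Rightarrow> 'a unitization" where
  "embed a = Unitization 0 a"

lemma embed_zero [simp]: "embed 0 = 0"
  by (simp add: embed_def zero_unitization_def)

lemma embed_eq_0_iff [simp]: "embed a = 0 \<longleftrightarrow> a = 0"
  by (simp add: embed_def zero_unitization_def)

lemma embed_eq_iff [simp]: "embed a = embed b \<longleftrightarrow> a = b"
  by (simp add: embed_def)

lemma embed_mult: "embed (a * b) = embed a * embed b"
  by (simp add: embed_def times_unitization_def)

lemma embed_star: "embed (star a) = star (embed a)"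
  by (simp add: embed_def star_unitization_def)

lemma norm_embed [simp]: "norm (embed a) = norm a"
proof (rule antisym)
  show "norm (embed a) \<le> norm a"
    using norm_unitization_le[of "embed a"] by (simp add: embed_def)
  show "norm a \<le> norm (embed a)"
  proof (cases "a = 0")
    case False
    have "norm a * norm a = norm (act (embed a) (star a))"
      by (simp add: act_def embed_def norm_mult_star power2_eq_square)
    also have "\<dots> \<le> onorm (act (embed a)) * norm a"
      using onorm[OF bounded_linear_act, of "embed a" "star a"] by simp
    also have "\<dots> \<le> norm (embed a) * norm a"
      by (intro mult_right_mono) (simp_all add: norm_unitization_def)
    finally show ?thesis
      using False by simp
  qed simp
qed

lemma mult_embed_in_range: "u * embed a \<in> range embed"
  by (rule range_eqI[of _ _ "act u a"]) (simp add: act_def embed_def times_unitization_def)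

lemma embed_mult_in_range: "embed a * u \<in> range embed"
  by (rule range_eqI[of _ _ "scalar_part u *\<^sub>C a + a * algebra_part u"])
    (simp add: embed_def times_unitization_def)

lemma annihilator_star: "b \<in> annihilator S \<Longrightarrow> star b \<in> annihilator S"
  by (simp add: annihilator_def orth_def star_star)

lemma mult_eq_0_of_mem_annihilator: "b \<in> annihilator S \<Longrightarrow> s \<in> S \<Longrightarrow> s * b = 0"
  by (simp add: annihilator_def orth_def)

lemma norm_prod_le:
  assumes "\<And>b d. b \<in> pos_unit_ball B \<Longrightarrow> d \<in> pos_unit_ball D \<Longrightarrow> norm (b * d) \<le> r"
    and "0 \<in> B" "0 \<in> D"
  shows "norm_prod B D \<le> r"
  unfolding norm_prod_def
proof (rule cSup_least)
  have "positive (0::'a)"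
    unfolding positive_def by (rule exI[of _ 0]) simp
  then have "0 \<in> pos_unit_ball B" "0 \<in> pos_unit_ball D"
    using assms(2,3) by (simp_all add: pos_unit_ball_def)
  then show "{norm (b * d) |b d. b \<in> pos_unit_ball B \<and> d \<in> pos_unit_ball D} \<noteq> {}"
    by blast
qed (use assms(1) in auto)

theorem theorem3p26:
  fixes \<epsilon> :: real
  assumes "\<epsilon> > 0"
  shows "separative \<epsilon> (annihilators :: 'a::cstar_algebra set set)"
  unfolding separative_def
proof (intro ballI impI)
  fix B C :: "'a set"
  assume "B \<in> annihilators" "C \<in> annihilators" "B \<subset> C"
  then obtain S T where B: "B = annihilator T" and C: "C = annihilator S"
    by (auto simp: annihilators_def)
  obtain a where "a \<in> C" "a \<notin> B"
    using \<open>B \<subset> C\<close> by blast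
  then obtain t where t: "t \<in> T" "t * a \<noteq> 0 \<or> t * star a \<noteq> 0"
    by (auto simp: B annihilator_def orth_def)
  then obtain z0 where z0: "z0 \<in> C" "t * z0 \<noteq> 0"
    using \<open>a \<in> C\<close> annihilator_star C by blast
  have ann: "s * embed z0 = 0" if "s \<in> embed ` S" for s
    using that z0(1) by (auto simp: C embed_mult[symmetric] mult_eq_0_of_mem_annihilator)
  have nz: "embed t * embed z0 \<noteq> 0"
    using z0(2) by (simp flip: embed_mult)
  show "\<exists>D\<in>annihilators. {0} \<noteq> D \<and> D \<subseteq> C \<and> norm_prod B D \<le> \<epsilon>"
  proof (rule almost_orthogonal_spectral_part[OF ann nz assms])
    fix e u v k
    assume e: "e = u * embed t * v" "e \<noteq> 0" "star e = e"
        "\<And>s. s \<in> embed ` S \<Longrightarrow> s * e = 0"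
      and k: "k * e = 0"
      and estimate: "\<And>b x. star b = b \<Longrightarrow> norm b \<le> 1 \<Longrightarrow> embed t * b = 0 \<Longrightarrow>
        (\<And>s. s \<in> embed ` S \<Longrightarrow> s * b = 0) \<Longrightarrow> (\<And>s. s \<in> embed ` S \<Longrightarrow> s * x = 0) \<Longrightarrow>
        k * x = 0 \<Longrightarrow> norm (b * x) \<le> \<epsilon> * norm x"
    obtain a' where "u * embed t = embed a'"
      using mult_embed_in_range[of u t] by auto
    then obtain e' where e': "e = embed e'"
      using embed_mult_in_range[of a' v] e(1) by auto
    \<comment> \<open>\<open>k\<close> lies in the unitization; the elements \<open>z * k\<close> of the algebra annihilate the same elements\<close>
    define D where "D = annihilator (S \<union> {y. \<exists>z. embed y = embed z * k})"
    have "D \<in> annihilators"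
      by (auto simp: D_def annihilators_def)
    moreover have "D \<subseteq> C"
      by (auto simp: D_def C annihilator_def)
    moreover have "{0} \<noteq> D"
    proof -
      have "star e' = e'"
        using e(3) by (simp add: e' flip: embed_star)
      moreover have "y * e' = 0" if "y \<in> S \<union> {y. \<exists>z. embed y = embed z * k}" for y
      proof -
        have "embed y * e = 0"
          using that e(4) k by (auto simp: mult.assoc)
        then show ?thesis
          by (simp add: e' flip: embed_mult)
      qed
      ultimately have "e' \<in> D"
        by (simp add: D_def annihilator_def orth_def)
      moreover have "e' \<noteq> 0"
        using e(2) by (auto simp: e')
      ultimately show ?thesis
        by blast
    qed
    moreover have "norm_prod B D \<le> \<epsilon>"
    proof (rule norm_prod_le)
      fix b d
      assume b: "b \<in> pos_unit_ball B" and d: "d \<in> pos_unit_ball D"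
      have "star b = b" "norm b \<le> 1" "b \<in> B"
        using b by (auto simp: pos_unit_ball_def positive_def star_mult star_star)
      moreover have "d \<in> D" "norm d \<le> 1"
        using d by (auto simp: pos_unit_ball_def)
      moreover have "k * embed d = 0"
      proof -
        obtain z where z: "star (k * embed d) = embed z"
          using mult_embed_in_range[of k d] by (auto simp flip: embed_star)
        obtain y where y: "embed y = embed z * k"
          using embed_mult_in_range[of z k] by (metis rangeE)
        have "y * d = 0"
          using \<open>d \<in> D\<close> y unfolding D_def by (blast intro: mult_eq_0_of_mem_annihilator)
        then have "embed z * k * embed d = 0"
          by (metis embed_mult embed_zero y)
        then have "star (k * embed d) * (k * embed d) = 0"
          by (simp add: z mult.assoc)
        then show ?thesis
          by simp
      qed
      ultimately have "norm (embed b * embed d) \<le> \<epsilon> * norm (embed d)"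
        using \<open>B \<subset> C\<close> \<open>D \<subseteq> C\<close> t(1)
        by (intro estimate)
          (auto simp: B C mult_eq_0_of_mem_annihilator simp flip: embed_star embed_mult)
      also have "\<dots> \<le> \<epsilon>"
        using \<open>norm d \<le> 1\<close> assms by (simp add: mult_left_le)
      finally show "norm (b * d) \<le> \<epsilon>"
        by (simp flip: embed_mult)
    qed (simp_all add: B D_def annihilator_def orth_def)
    ultimately show "\<exists>D\<in>annihilators. {0} \<noteq> D \<and> D \<subseteq> C \<and> norm_prod B D \<le> \<epsilon>"
      by blast
  qed
qed

end
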